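(* Let $B_n^{M,2}$ be the second modified Bernstein operator. Then: (i) for every $f\in C^1[0,1]$ and every integer $n\ge3$, $$\|B_n^{M,2}f-f\|_\infty\le \frac18\,\omega_1\!\left(f';\frac1n\right)+\frac{1}{\sqrt{n-2}}\,\omega_1\!\left(f';\frac1{\sqrt{n-2}}\right)+\frac2n\|f'\|_\infty ,$$ and the right-hand side is $o(1)$ as $n\to\infty$; (ii) for every $f\in C^2[0,1]$, $\|B_n^{M,2}f-f\|_\infty=\mathcal O\!\left(\frac1n\right)$ as $n\to\infty$.
   Context: Bernstein basis: $p_{n,k}(x)=\binom nk x^k(1-x)^{n-k}$ for $0\le k\le n$, $x\in[0,1]$ (with $0^0=1$), and $p_{n,k}=0$ if $k<0$ or $k>n$. Second modified Bernstein operator: for $f\in C[0,1]$, $x\in[0,1]$, $B_n^{M,2}(f;x)=\sum_{k=0}^n p_{n,k}^{M,2}(x)f(k/n)$, where $$p_{n,k}^{M,2}(x)=\left[\tfrac n2x^2+\left(-1-\tfrac n2\right)x+1\right]p_{n-2,k}(x)+nx(1-x)\,p_{n-2,k-1}(x)+\left[\tfrac n2x^2+\left(-\tfrac n2+1\right)x\right]p_{n-2,k-2}(x).$$ $\omega_1(g;\delta)=\sup\{|g(s)-g(t)|: s,t\in[0,1],\ |s-t|\le\delta\}$; $\|\cdot\|_\infty$ is the sup norm on $[0,1]$. *)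

theory Defs
  imports "HOL-Analysis.Analysis" "HOL-Library.Landau_Symbols"
begin

text \<open>Functions on the unit interval are total functions \<^typ>\<open>real \<Rightarrow> real\<close>, of which only the
  values on \<^term>\<open>{0..1::real}\<close> matter. Derivatives are taken within the interval, hence are
  one-sided at the end points.\<close>

definition deriv01 :: "(real \<Rightarrow> real) \<Rightarrow> real \<Rightarrow> real" where
  "deriv01 f x = vector_derivative f (at x within {0..1})"

definition C1_01 :: "(real \<Rightarrow> real) set" where
  "C1_01 = {f. f differentiable_on {0..1} \<and> continuous_on {0..1} (deriv01 f)}"

definition C2_01 :: "(real \<Rightarrow> real) set" where
  "C2_01 = {f \<in> C1_01. deriv01 f \<in> C1_01}"

definition sup_norm01 :: "(real \<Rightarrow> real) \<Rightarrow> real" where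
  "sup_norm01 g = (SUP x\<in>{0..1}. \<bar>g x\<bar>)"

definition omega1 :: "(real \<Rightarrow> real) \<Rightarrow> real \<Rightarrow> real" where
  "omega1 g \<delta> = Sup {\<bar>g s - g t\<bar> | s t. s \<in> {0..1} \<and> t \<in> {0..1} \<and> \<bar>s - t\<bar> \<le> \<delta>}"

text \<open>The index is an integer, so that shifted indices may become negative.\<close>

definition bernstein_basis :: "nat \<Rightarrow> int \<Rightarrow> real \<Rightarrow> real" where
  "bernstein_basis n k x = (if 0 \<le> k \<and> k \<le> int n then Bernstein n (nat k) x else 0)"

text \<open>Only meaningful for \<open>n \<ge> 2\<close>: the subtraction \<open>n - 2\<close> is truncated.\<close>

definition bernstein_basis_M2 :: "nat \<Rightarrow> int \<Rightarrow> real \<Rightarrow> real" where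
  "bernstein_basis_M2 n k x =
     (real n / 2 * x^2 + (- 1 - real n / 2) * x + 1) * bernstein_basis (n - 2) k x
     + real n * x * (1 - x) * bernstein_basis (n - 2) (k - 1) x
     + (real n / 2 * x^2 + (- (real n / 2) + 1) * x) * bernstein_basis (n - 2) (k - 2) x"

definition bernstein_M2 :: "nat \<Rightarrow> (real \<Rightarrow> real) \<Rightarrow> real \<Rightarrow> real" where
  "bernstein_M2 n f x = (\<Sum>k=0..n. bernstein_basis_M2 n (int k) x * f (real k / real n))"

end

theory Submission imports Defs begin

text \<open>Put \<open>m = n - 2\<close>. The weights of \<open>bernstein_M2\<close> are arranged so that
  \<open>B\<^sub>n\<^sup>M\<^sup>,\<^sup>2 f(x)\<close> is the average, against the basis of degree \<open>m\<close>, of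
  \<open>(1 - x) f(k/n) + x f((k+2)/n) - n/2 x(1 - x) \<Delta>\<^sup>2 f(k/n)\<close>. The second difference is at most
  \<open>\<omega>\<^sub>1(f'; 1/n) / n\<close>, which gives the term with factor \<open>1/8\<close>. Replacing both nodes \<open>k/n\<close> and
  \<open>(k+2)/n\<close> by \<open>k/m\<close> costs at most \<open>2/n \<parallel>f'\<parallel>\<close>. What remains is the classical Bernstein operator of
  degree \<open>m\<close>, which is handled by a first-order Taylor expansion at \<open>x\<close> and the variance
  \<open>x(1 - x)/m \<le> 1/(4m)\<close>.\<close>

section \<open>Derivatives and the sup norm on the unit interval\<close>

lemma C1_01_has_real_derivative:
  assumes "f \<in> C1_01" "x \<in> {0..1}"
  shows "(f has_real_derivative deriv01 f x) (at x within {0..1})"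
proof -
  have "f differentiable (at x within {0..1})"
    using assms by (auto simp: C1_01_def differentiable_on_def)
  then show ?thesis
    unfolding deriv01_def vector_derivative_works has_real_derivative_iff_has_vector_derivative .
qed

lemma C1_01_continuous_deriv: "f \<in> C1_01 \<Longrightarrow> continuous_on {0..1} (deriv01 f)"
  by (simp add: C1_01_def)

lemma sup_norm01_upper:
  assumes "continuous_on {0..1} g" "x \<in> {0..1}"
  shows "\<bar>g x\<bar> \<le> sup_norm01 g"
proof -
  have "compact ((\<lambda>x. \<bar>g x\<bar>) ` {0..1})"
    using assms(1) by (intro compact_continuous_image continuous_intros) auto
  then have "bdd_above ((\<lambda>x. \<bar>g x\<bar>) ` {0..1})"
    by (intro bounded_imp_bdd_above compact_imp_bounded)
  then show ?thesis
    unfolding sup_norm01_def using assms(2) by (rule cSUP_upper[rotated])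
qed

lemma sup_norm01_le:
  assumes "\<And>x. x \<in> {0..1} \<Longrightarrow> \<bar>g x\<bar> \<le> c"
  shows "sup_norm01 g \<le> c"
  unfolding sup_norm01_def using assms by (intro cSUP_least) auto

text \<open>The bound \<open>c\<close> guarantees that the supremum is a genuine one. It replaces
  continuity, so that the lemma also applies to the error \<open>bernstein_M2 n f x - f x\<close>,
  for which only an estimate is at hand.\<close>

lemma sup_norm01_nonneg:
  assumes "\<And>x. x \<in> {0..1} \<Longrightarrow> \<bar>g x\<bar> \<le> c"
  shows "0 \<le> sup_norm01 g"
proof -
  have "bdd_above ((\<lambda>x. \<bar>g x\<bar>) ` {0..1})"
    using assms by (intro bdd_aboveI2)
  then have "\<bar>g 0\<bar> \<le> sup_norm01 g"
    unfolding sup_norm01_def by (rule cSUP_upper[rotated]) auto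
  then show ?thesis
    by linarith
qed

subsection \<open>The modulus of continuity\<close>

lemma omega1_upper:
  assumes "continuous_on {0..1} g" "s \<in> {0..1}" "t \<in> {0..1}" "\<bar>s - t\<bar> \<le> \<delta>"
  shows "\<bar>g s - g t\<bar> \<le> omega1 g \<delta>"
  unfolding omega1_def
proof (rule cSup_upper)
  show "bdd_above {\<bar>g s - g t\<bar> |s t. s \<in> {0..1} \<and> t \<in> {0..1} \<and> \<bar>s - t\<bar> \<le> \<delta>}"
  proof (rule bdd_aboveI)
    fix y assume "y \<in> {\<bar>g s - g t\<bar> |s t. s \<in> {0..1} \<and> t \<in> {0..1} \<and> \<bar>s - t\<bar> \<le> \<delta>}"
    then obtain s t where "y = \<bar>g s - g t\<bar>" "s \<in> {0..1}" "t \<in> {0..1}"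
      by blast
    then show "y \<le> 2 * sup_norm01 g"
      using sup_norm01_upper[OF assms(1), of s] sup_norm01_upper[OF assms(1), of t] by linarith
  qed
qed (use assms in blast)

lemma omega1_le:
  assumes "0 \<le> \<delta>"
    and "\<And>s t. \<lbrakk>s \<in> {0..1}; t \<in> {0..1}; \<bar>s - t\<bar> \<le> \<delta>\<rbrakk> \<Longrightarrow> \<bar>g s - g t\<bar> \<le> c"
  shows "omega1 g \<delta> \<le> c"
  unfolding omega1_def
proof (rule cSup_least)
  have "\<bar>g 0 - g 0\<bar> \<in> {\<bar>g s - g t\<bar> |s t. s \<in> {0..1} \<and> t \<in> {0..1} \<and> \<bar>s - t\<bar> \<le> \<delta>}"
    using assms(1) by (intro CollectI exI[of _ "0::real"]) auto
  then show "{\<bar>g s - g t\<bar> |s t. s \<in> {0..1} \<and> t \<in> {0..1} \<and> \<bar>s - t\<bar> \<le> \<delta>} \<noteq> {}"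
    by blast
qed (use assms(2) in blast)

lemma omega1_nonneg:
  assumes "continuous_on {0..1} g" "0 \<le> \<delta>"
  shows "0 \<le> omega1 g \<delta>"
  using omega1_upper[OF assms(1), of 0 0 \<delta>] assms(2) by simp

text \<open>Continuity on a compact interval is uniform (Heine-Cantor). The limit is one-sided
  because the set in \<open>omega1\<close> is empty for negative \<open>\<delta>\<close>.\<close>

lemma omega1_tendsto_0:
  assumes "continuous_on {0..1} g"
  shows "(omega1 g \<longlongrightarrow> 0) (at_right 0)"
proof (rule tendstoI)
  fix e :: real assume "0 < e"
  have "uniformly_continuous_on {0..1} g"
    using assms compact_uniformly_continuous by blast
  \<comment> \<open>\<open>e / 2\<close> rather than \<open>e\<close>: passing to the supremum turns
    the strict inequality into a weak one.\<close>
  then obtain d where d: "d > 0"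
    "\<And>x x'. \<lbrakk>x \<in> {0..1}; x' \<in> {0..1}; dist x' x < d\<rbrakk> \<Longrightarrow> dist (g x') (g x) < e / 2"
    using \<open>0 < e\<close> unfolding uniformly_continuous_on_def by (meson half_gt_zero)
  have "dist (omega1 g \<delta>) 0 < e" if "0 < \<delta>" "\<delta> < d" for \<delta>
  proof -
    have "omega1 g \<delta> \<le> e / 2"
    proof (rule omega1_le)
      fix s t :: real assume "s \<in> {0..1}" "t \<in> {0..1}" "\<bar>s - t\<bar> \<le> \<delta>"
      then show "\<bar>g s - g t\<bar> \<le> e / 2"
        using d(2)[of t s] that by (simp add: dist_real_def)
    qed (use that in simp)
    then show ?thesis
      using omega1_nonneg[OF assms, of \<delta>] that \<open>0 < e\<close> by simp
  qed
  then show "\<forall>\<^sub>F \<delta> in at_right 0. dist (omega1 g \<delta>) 0 < e"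
    using d(1) unfolding eventually_at_right_field by blast
qed

text \<open>Walk from \<open>s\<close> towards \<open>t\<close> in \<open>N\<close> steps of length
  at most \<open>\<delta>\<close>; each step changes \<open>g\<close> by at most
  \<open>omega1 g \<delta>\<close>.\<close>

lemma omega1_multiple:
  assumes "continuous_on {0..1} g" "0 \<le> \<delta>" "s \<in> {0..1}" "t \<in> {0..1}" "\<bar>s - t\<bar> \<le> real N * \<delta>"
  shows "\<bar>g s - g t\<bar> \<le> real N * omega1 g \<delta>"
  using assms(3-5)
proof (induction N arbitrary: s)
  case (Suc N)
  show ?case
  proof (cases "\<bar>s - t\<bar> \<le> \<delta>")
    case True
    then have "\<bar>g s - g t\<bar> \<le> omega1 g \<delta>"
      using omega1_upper assms(1) Suc.prems by blast
    also have "\<dots> \<le> real (Suc N) * omega1 g \<delta>"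
      using omega1_nonneg[OF assms(1,2)] by (simp add: algebra_simps)
    finally show ?thesis .
  next
    case False
    \<comment> \<open>One step of length \<open>\<delta>\<close> from \<open>s\<close> towards
      \<open>t\<close>. As the distance exceeds \<open>\<delta>\<close>, it does not overshoot, so
      \<open>s'\<close> stays in the interval.\<close>
    define s' where "s' = (if s < t then s + \<delta> else s - \<delta>)"
    have s': "s' \<in> {0..1}" "\<bar>s - s'\<bar> \<le> \<delta>" "\<bar>s' - t\<bar> \<le> real N * \<delta>"
      using False Suc.prems assms(2) by (auto simp: s'_def algebra_simps split: if_splits)
    have "\<bar>g s - g s'\<bar> \<le> omega1 g \<delta>" "\<bar>g s' - g t\<bar> \<le> real N * omega1 g \<delta>"
      using omega1_upper[OF assms(1)] Suc.IH Suc.prems s' by blast+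
    then show ?thesis
      by (simp add: algebra_simps)
  qed
qed simp

text \<open>The number of steps needed is the ceiling of
  \<open>\<bar>s - t\<bar> / \<delta>\<close>, which exceeds this quotient by at most 1.\<close>

lemma omega1_dilation:
  assumes "continuous_on {0..1} g" "0 < \<delta>" "s \<in> {0..1}" "t \<in> {0..1}"
  shows "\<bar>g s - g t\<bar> \<le> (1 + \<bar>s - t\<bar> / \<delta>) * omega1 g \<delta>"
proof -
  define N where "N = nat \<lceil>\<bar>s - t\<bar> / \<delta>\<rceil>"
  have "0 \<le> \<bar>s - t\<bar> / \<delta>"
    using assms(2) by simp
  then have N: "\<bar>s - t\<bar> / \<delta> \<le> real N" "real N \<le> 1 + \<bar>s - t\<bar> / \<delta>"
    unfolding N_def by linarith+
  have "\<bar>g s - g t\<bar> \<le> real N * omega1 g \<delta>"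
    using N(1) assms by (intro omega1_multiple) (auto simp: field_simps)
  also have "\<dots> \<le> (1 + \<bar>s - t\<bar> / \<delta>) * omega1 g \<delta>"
    using N(2) omega1_nonneg assms by (intro mult_right_mono) auto
  finally show ?thesis .
qed

subsection \<open>Mean value estimates on the unit interval\<close>

text \<open>The points may come in either order, as a node can lie on either side of
  \<open>x\<close>. The distance bound on \<open>z\<close> is what the Taylor estimate uses.\<close>

lemma mean_value_01:
  assumes df: "\<And>x. x \<in> {0..1} \<Longrightarrow> (f has_real_derivative f' x) (at x within {0..1})"
    and "s \<in> {0..1}" "t \<in> {0..1}"
  obtains z where "z \<in> {0..1}" "\<bar>z - s\<bar> \<le> \<bar>t - s\<bar>" "f t - f s = f' z * (t - s)"
proof -
  have *: "\<exists>z\<in>{a..b}. f b - f a = f' z * (b - a)" if "0 \<le> a" "a \<le> b" "b \<le> 1" for a b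
  proof (rule mvt_very_simple[OF that(2)])
    fix x assume x: "a \<le> x" "x \<le> b"
    then have "(f has_real_derivative f' x) (at x within {a..b})"
      using that by (intro DERIV_subset[OF df]) auto
    then show "(f has_derivative (*) (f' x)) (at x within {a..b})"
      by (simp add: has_field_derivative_def)
  qed
  show ?thesis
  proof (cases "s \<le> t")
    case True
    then obtain z where "z \<in> {s..t}" "f t - f s = f' z * (t - s)"
      using *[of s t] assms by auto
    then show ?thesis
      using that[of z] assms by auto
  next
    case False
    then obtain z where "z \<in> {t..s}" "f s - f t = f' z * (s - t)"
      using *[of t s] assms by auto
    then show ?thesis
      using that[of z] assms False by (auto simp: algebra_simps)
  qed
qed

lemma lipschitz_01:
  assumes df: "\<And>x. x \<in> {0..1} \<Longrightarrow> (f has_real_derivative f' x) (at x within {0..1})"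
    and cont: "continuous_on {0..1} f'"
    and "s \<in> {0..1}" "t \<in> {0..1}"
  shows "\<bar>f t - f s\<bar> \<le> sup_norm01 f' * \<bar>t - s\<bar>"
proof -
  obtain z where z: "z \<in> {0..1}" "f t - f s = f' z * (t - s)"
    using mean_value_01[OF df] assms(3,4) by metis
  then have "\<bar>f t - f s\<bar> = \<bar>f' z\<bar> * \<bar>t - s\<bar>"
    by (simp add: abs_mult)
  also have "\<dots> \<le> sup_norm01 f' * \<bar>t - s\<bar>"
    using sup_norm01_upper[OF cont z(1)] by (intro mult_right_mono) auto
  finally show ?thesis .
qed

text \<open>Applying the mean value theorem to \<open>t \<mapsto> f (t + h) - f t\<close> gives \<open>\<omega>\<^sub>1(f'; h)\<close>; applying it
  to the two first differences separately would only give \<open>\<omega>\<^sub>1(f'; 2h)\<close>.\<close>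

lemma second_difference_le:
  assumes df: "\<And>x. x \<in> {0..1} \<Longrightarrow> (f has_real_derivative f' x) (at x within {0..1})"
    and cont: "continuous_on {0..1} f'"
    and h: "0 \<le> a" "0 < h" "a + 2 * h \<le> 1"
  shows "\<bar>f a - 2 * f (a + h) + f (a + 2 * h)\<bar> \<le> h * omega1 f' h"
proof -
  have "\<exists>z\<in>{a..a + h}. (f (a + h + h) - f (a + h)) - (f (a + h) - f a)
      = (f' (z + h) - f' z) * (a + h - a)"
  proof (rule mvt_very_simple)
    fix x assume x: "a \<le> x" "x \<le> a + h"
    have 1: "(f has_real_derivative f' x) (at x within {a..a + h})"
      using x h by (intro DERIV_subset[OF df]) auto
    \<comment> \<open>The shifted interval is \<open>{a + h..a + 2 * h}\<close>, still inside the
      unit interval, so the derivative within it is available for the chain rule.\<close>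
    have "(f has_real_derivative f' (x + h)) (at (x + h) within (\<lambda>x. x + h) ` {a..a + h})"
      using x h by (intro DERIV_subset[OF df]) auto
    moreover have "((\<lambda>x. x + h) has_real_derivative 1) (at x within {a..a + h})"
      by (auto intro!: derivative_eq_intros)
    ultimately have "(f \<circ> (\<lambda>x. x + h) has_real_derivative f' (x + h) * 1) (at x within {a..a + h})"
      by (rule DERIV_image_chain)
    then have "((\<lambda>x. f (x + h)) has_real_derivative f' (x + h)) (at x within {a..a + h})"
      by (simp add: o_def)
    then have "((\<lambda>x. f (x + h) - f x) has_real_derivative f' (x + h) - f' x) (at x within {a..a + h})"
      using 1 by (rule DERIV_diff)
    then show "((\<lambda>x. f (x + h) - f x) has_derivative (*) (f' (x + h) - f' x)) (at x within {a..a + h})"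
      by (simp add: has_field_derivative_def)
  qed (use h in simp)
  then obtain z where z: "z \<in> {a..a + h}"
    "f a - 2 * f (a + h) + f (a + 2 * h) = (f' (z + h) - f' z) * h"
    by (auto simp: algebra_simps)
  have "\<bar>f' (z + h) - f' z\<bar> \<le> omega1 f' h"
    using z(1) h by (intro omega1_upper[OF cont]) auto
  then show ?thesis
    using h(2) unfolding z(2) by (simp add: abs_mult mult.commute)
qed

text \<open>By the mean value theorem the remainder equals \<open>(f' z - f' x) * (t - x)\<close>
  with \<open>z\<close> no farther from \<open>x\<close> than \<open>t\<close> is;
  \<open>omega1_dilation\<close> bounds the first factor.\<close>

lemma taylor1_le:
  assumes df: "\<And>x. x \<in> {0..1} \<Longrightarrow> (f has_real_derivative f' x) (at x within {0..1})"
    and cont: "continuous_on {0..1} f'"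
    and "x \<in> {0..1}" "t \<in> {0..1}" "0 < \<delta>"
  shows "\<bar>f t - f x - f' x * (t - x)\<bar> \<le> (\<bar>t - x\<bar> + (t - x)\<^sup>2 / \<delta>) * omega1 f' \<delta>"
proof -
  obtain z where z: "z \<in> {0..1}" "\<bar>z - x\<bar> \<le> \<bar>t - x\<bar>" "f t - f x = f' z * (t - x)"
    using mean_value_01[OF df] assms(3,4) by metis
  have "\<bar>f' z - f' x\<bar> \<le> (1 + \<bar>z - x\<bar> / \<delta>) * omega1 f' \<delta>"
    using z assms by (intro omega1_dilation)
  also have "\<dots> \<le> (1 + \<bar>t - x\<bar> / \<delta>) * omega1 f' \<delta>"
    using z(2) assms(5) omega1_nonneg[OF cont, of \<delta>]
    by (intro mult_right_mono add_left_mono divide_right_mono) auto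
  finally have le: "\<bar>f' z - f' x\<bar> \<le> (1 + \<bar>t - x\<bar> / \<delta>) * omega1 f' \<delta>" .
  have "\<bar>f t - f x - f' x * (t - x)\<bar> = \<bar>t - x\<bar> * \<bar>f' z - f' x\<bar>"
    by (simp add: z(3) algebra_simps flip: abs_mult)
  also have "\<dots> \<le> \<bar>t - x\<bar> * ((1 + \<bar>t - x\<bar> / \<delta>) * omega1 f' \<delta>)"
    using le by (intro mult_left_mono) auto
  also have "\<dots> = (\<bar>t - x\<bar> + \<bar>t - x\<bar>\<^sup>2 / \<delta>) * omega1 f' \<delta>"
    by (simp add: algebra_simps power2_eq_square del: power2_abs)
  finally show ?thesis
    by simp
qed

subsection \<open>The classical Bernstein operator\<close>

lemma sum_Bernstein_deviation:
  assumes "0 < m"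
  shows "(\<Sum>k\<le>m. Bernstein m k x * (real k / real m - x)) = 0"
proof -
  have "(\<Sum>k\<le>m. Bernstein m k x * (real k / real m - x))
      = (\<Sum>k\<le>m. real k * Bernstein m k x) / real m - (\<Sum>k\<le>m. Bernstein m k x) * x"
    by (simp only: sum_divide_distrib sum_distrib_right flip: sum_subtractf)
      (simp add: algebra_simps)
  then show ?thesis
    using assms by simp
qed

lemma sum_Bernstein_variance:
  assumes "0 < m"
  shows "(\<Sum>k\<le>m. Bernstein m k x * (real k / real m - x)\<^sup>2) = x * (1 - x) / real m"
proof -
  \<comment> \<open>The square is expanded in \<open>k (k - 1)\<close>, \<open>k\<close> and
    \<open>1\<close>, the moments with known closed forms.\<close>
  have "Bernstein m k x * (real k / real m - x)\<^sup>2
      = real k * (real k - 1) * Bernstein m k x / (real m)\<^sup>2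
        + real k * Bernstein m k x * (1 / (real m)\<^sup>2 - 2 * x / real m) + Bernstein m k x * x\<^sup>2" for k
    using assms by (simp add: field_simps power2_eq_square)
  then have "(\<Sum>k\<le>m. Bernstein m k x * (real k / real m - x)\<^sup>2)
      = (\<Sum>k\<le>m. real k * (real k - 1) * Bernstein m k x) / (real m)\<^sup>2
        + (\<Sum>k\<le>m. real k * Bernstein m k x) * (1 / (real m)\<^sup>2 - 2 * x / real m)
        + (\<Sum>k\<le>m. Bernstein m k x) * x\<^sup>2"
    by (simp only: sum.distrib sum_divide_distrib sum_distrib_right)
  also have "\<dots> = x * (1 - x) / real m"
    unfolding sum_Bernstein sum_k_Bernstein sum_kk_Bernstein
    using assms by (simp add: field_simps power2_eq_square)
  finally show ?thesis .
qed

lemma mult_one_minus_le_quarter: "x * (1 - x) \<le> 1 / 4" for x :: real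
  using zero_le_power2[of "x - 1 / 2"] by (simp add: power2_eq_square algebra_simps)

lemma abs_sum_Bernstein_le:
  assumes "x \<in> {0..1}" "\<And>k. k \<le> m \<Longrightarrow> \<bar>g k\<bar> \<le> h k"
  shows "\<bar>\<Sum>k\<le>m. Bernstein m k x * g k\<bar> \<le> (\<Sum>k\<le>m. Bernstein m k x * h k)"
proof -
  have "\<bar>\<Sum>k\<le>m. Bernstein m k x * g k\<bar> \<le> (\<Sum>k\<le>m. \<bar>Bernstein m k x * g k\<bar>)"
    by (rule sum_abs)
  also have "\<dots> \<le> (\<Sum>k\<le>m. Bernstein m k x * h k)"
    using assms Bernstein_nonneg[of x m]
    by (intro sum_mono) (auto simp: abs_mult intro!: mult_left_mono)
  finally show ?thesis .
qed

text \<open>The Taylor estimate is taken with \<open>\<delta> = 1 / r\<close>, where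
  \<open>r\<^sup>2 = m\<close>, matching the order of the standard deviation. The linear part
  averages to zero, which leaves the means of \<open>\<bar>y k\<bar>\<close> and
  \<open>r * (y k)\<^sup>2\<close>.\<close>

lemma Bernstein_error_C1:
  assumes df: "\<And>x. x \<in> {0..1} \<Longrightarrow> (f has_real_derivative f' x) (at x within {0..1})"
    and cont: "continuous_on {0..1} f'"
    and x: "x \<in> {0..1}" and m: "0 < m"
  shows "\<bar>(\<Sum>k\<le>m. Bernstein m k x * f (real k / real m)) - f x\<bar>
      \<le> 1 / sqrt (real m) * omega1 f' (1 / sqrt (real m))"
proof -
  define r where "r = sqrt (real m)"
  have r: "0 < r" "r\<^sup>2 = real m"
    using m by (simp_all add: r_def)
  define W where "W = omega1 f' (1 / r)"
  have W: "0 \<le> W"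
    using r omega1_nonneg[OF cont] by (simp add: W_def)
  define y where "y k = real k / real m - x" for k
  have "(\<Sum>k\<le>m. Bernstein m k x * f (real k / real m)) - f x
      = (\<Sum>k\<le>m. Bernstein m k x * f (real k / real m)) - (\<Sum>k\<le>m. Bernstein m k x) * f x
        - (\<Sum>k\<le>m. Bernstein m k x * y k) * f' x"
    using sum_Bernstein_deviation[OF m, of x] by (simp add: y_def)
  also have "\<dots> = (\<Sum>k\<le>m. Bernstein m k x * (f (real k / real m) - f x - f' x * y k))"
    by (simp only: sum_distrib_right flip: sum_subtractf) (simp add: algebra_simps)
  finally have eq: "(\<Sum>k\<le>m. Bernstein m k x * f (real k / real m)) - f x
      = (\<Sum>k\<le>m. Bernstein m k x * (f (real k / real m) - f x - f' x * y k))" .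
  have "\<bar>(\<Sum>k\<le>m. Bernstein m k x * f (real k / real m)) - f x\<bar>
      \<le> (\<Sum>k\<le>m. Bernstein m k x * ((1 / (2 * r) + (y k)\<^sup>2 * (3 / 2 * r)) * W))"
    unfolding eq
  proof (rule abs_sum_Bernstein_le[OF x])
    fix k assume "k \<le> m"
    then have "\<bar>f (real k / real m) - f x - f' x * y k\<bar> \<le> (\<bar>y k\<bar> + (y k)\<^sup>2 / (1 / r)) * W"
      unfolding y_def W_def using r m x by (intro taylor1_le[OF df cont]) auto
    also have "\<dots> \<le> (1 / (2 * r) + (y k)\<^sup>2 * (3 / 2 * r)) * W"
    proof (rule mult_right_mono[OF _ W])
      \<comment> \<open>Termwise arithmetic-geometric mean inequality. It trades the absolute
        deviation for the variance, in place of the Cauchy-Schwarz inequality for the sums.\<close>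
      have "2 * (r * \<bar>y k\<bar>) \<le> 1 + (r * \<bar>y k\<bar>)\<^sup>2"
        using zero_le_power2[of "r * \<bar>y k\<bar> - 1"] by (simp add: power2_eq_square algebra_simps)
      then have "\<bar>y k\<bar> \<le> 1 / (2 * r) + (y k)\<^sup>2 * r / 2"
        using r(1) by (simp add: field_simps power2_eq_square)
      then show "\<bar>y k\<bar> + (y k)\<^sup>2 / (1 / r) \<le> 1 / (2 * r) + (y k)\<^sup>2 * (3 / 2 * r)"
        by simp
    qed
    finally show "\<bar>f (real k / real m) - f x - f' x * y k\<bar>
        \<le> (1 / (2 * r) + (y k)\<^sup>2 * (3 / 2 * r)) * W" .
  qed
  also have "\<dots> = ((\<Sum>k\<le>m. Bernstein m k x) * (1 / (2 * r))
      + (\<Sum>k\<le>m. Bernstein m k x * (y k)\<^sup>2) * (3 / 2 * r)) * W"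
    by (simp only: sum_distrib_right flip: sum.distrib) (simp add: algebra_simps)
  also have "\<dots> = (1 / (2 * r) + x * (1 - x) * (3 / (2 * r))) * W"
    using r(1) unfolding y_def sum_Bernstein_variance[OF m] unfolding r(2)[symmetric]
    by (simp add: power2_eq_square field_simps)
  \<comment> \<open>The factor is now \<open>1/2 + 3/8 = 7/8\<close> times \<open>1 / r\<close>, so
    the final bound has room to spare.\<close>
  also have "\<dots> \<le> (1 / (2 * r) + 1 / 4 * (3 / (2 * r))) * W"
    using r W mult_one_minus_le_quarter[of x]
    by (intro mult_right_mono add_left_mono) auto
  also have "\<dots> \<le> 1 / r * W"
    using r W by (intro mult_right_mono) (auto simp: field_simps)
  finally show ?thesis
    by (simp add: W_def r_def)
qed

subsection \<open>The modified operator\<close>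

text \<open>Since \<open>bernstein_basis\<close> vanishes outside its index range, only
  \<open>k\<close> from \<open>j\<close> to \<open>m + j\<close> contribute; the hypothesis keeps
  all of these within the sum up to \<open>n\<close>.\<close>

lemma sum_bernstein_basis_shift:
  assumes "m + j \<le> n"
  shows "(\<Sum>k=0..n. bernstein_basis m (int k - int j) x * F k)
      = (\<Sum>i\<le>m. Bernstein m i x * F (i + j))"
proof -
  have "(\<Sum>k=0..n. bernstein_basis m (int k - int j) x * F k)
      = (\<Sum>k=j..m + j. Bernstein m (k - j) x * F k)"
    using assms by (intro sum.mono_neutral_cong_right)
      (auto simp: bernstein_basis_def nat_diff_distrib)
  also have "\<dots> = (\<Sum>i\<le>m. Bernstein m i x * F (i + j))"
    by (rule sum.reindex_bij_witness[of _ "\<lambda>i. i + j" "\<lambda>k. k - j"]) auto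
  finally show ?thesis .
qed

text \<open>The three coefficients are \<open>(1 - x) - c\<close>, \<open>2 * c\<close> and
  \<open>x - c\<close> with \<open>c = n / 2 * x * (1 - x)\<close>. The parts with \<open>c\<close>
  combine to minus a second difference.\<close>

lemma bernstein_M2_eq:
  assumes "2 \<le> n"
  shows "bernstein_M2 n f x = (\<Sum>k\<le>n - 2. Bernstein (n - 2) k x *
      ((1 - x) * f (real k / real n) + x * f (real (k + 2) / real n)
       - real n / 2 * (x * (1 - x)) *
         (f (real k / real n) - 2 * f (real (k + 1) / real n) + f (real (k + 2) / real n))))"
proof -
  define F where "F k = f (real k / real n)" for k
  define A B C where "A = real n / 2 * x^2 + (- 1 - real n / 2) * x + 1"
    and "B = real n * x * (1 - x)" and "C = real n / 2 * x^2 + (- (real n / 2) + 1) * x"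
  have "bernstein_M2 n f x
      = A * (\<Sum>k=0..n. bernstein_basis (n - 2) (int k - int 0) x * F k)
        + B * (\<Sum>k=0..n. bernstein_basis (n - 2) (int k - int 1) x * F k)
        + C * (\<Sum>k=0..n. bernstein_basis (n - 2) (int k - int 2) x * F k)"
    unfolding bernstein_M2_def bernstein_basis_M2_def F_def[symmetric]
      A_def[symmetric] B_def[symmetric] C_def[symmetric]
    by (simp add: sum_distrib_left sum.distrib algebra_simps)
  also have "\<dots> = A * (\<Sum>i\<le>n - 2. Bernstein (n - 2) i x * F (i + 0))
      + B * (\<Sum>i\<le>n - 2. Bernstein (n - 2) i x * F (i + 1))
      + C * (\<Sum>i\<le>n - 2. Bernstein (n - 2) i x * F (i + 2))"
    using assms by (subst (1 2 3) sum_bernstein_basis_shift) auto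
  also have "\<dots> = (\<Sum>k\<le>n - 2. Bernstein (n - 2) k x * (A * F k + B * F (k + 1) + C * F (k + 2)))"
    by (simp add: sum_distrib_left sum.distrib algebra_simps)
  also have "\<dots> = (\<Sum>k\<le>n - 2. Bernstein (n - 2) k x * ((1 - x) * F k + x * F (k + 2)
      - real n / 2 * (x * (1 - x)) * (F k - 2 * F (k + 1) + F (k + 2))))"
    by (intro sum.cong refl arg_cong2[where f = "(*)"])
      (simp add: A_def B_def C_def power2_eq_square field_simps)
  finally show ?thesis
    unfolding F_def .
qed

text \<open>The bracket \<open>G k\<close> is compared with \<open>f (k / m)\<close> uniformly in
  \<open>k\<close>. The weights of degree \<open>m\<close> are nonnegative with sum 1, so this bound
  survives averaging, and \<open>Bernstein_error_C1\<close> supplies the rest.\<close>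

lemma bernstein_M2_error_C1:
  assumes df: "\<And>x. x \<in> {0..1} \<Longrightarrow> (f has_real_derivative f' x) (at x within {0..1})"
    and cont: "continuous_on {0..1} f'"
    and x: "x \<in> {0..1}" and n: "3 \<le> n"
  shows "\<bar>bernstein_M2 n f x - f x\<bar>
      \<le> 1 / 8 * omega1 f' (1 / real n)
        + 1 / sqrt (real n - 2) * omega1 f' (1 / sqrt (real n - 2))
        + 2 / real n * sup_norm01 f'"
proof -
  define m where "m = n - 2"
  have m: "0 < m" "real n = real m + 2"
    using n by (auto simp: m_def)
  define M where "M = sup_norm01 f'"
  have M: "0 \<le> M"
    unfolding M_def using sup_norm01_upper[OF cont] by (rule sup_norm01_nonneg)
  define G where "G k = (1 - x) * f (real k / real n) + x * f (real (k + 2) / real n)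
       - real n / 2 * (x * (1 - x)) *
         (f (real k / real n) - 2 * f (real (k + 1) / real n) + f (real (k + 2) / real n))" for k
  have G: "\<bar>G k - f (real k / real m)\<bar> \<le> 1 / 8 * omega1 f' (1 / real n) + 2 / real n * M"
    if k: "k \<le> m" for k
  proof -
    define p where "p = real k / real m"
    have p: "0 \<le> p" "p \<le> 1" "real k = p * real m"
      using k m by (auto simp: p_def)
    have "\<bar>f (real k / real n) - 2 * f (real k / real n + 1 / real n) + f (real k / real n + 2 * (1 / real n))\<bar>
        \<le> 1 / real n * omega1 f' (1 / real n)"
    \<comment> \<open>The rightmost node is \<open>(k + 2) / n\<close>, which is at most 1 because
      \<open>k \<le> m = n - 2\<close>.\<close>
    proof (intro second_difference_le[OF df cont])
      have "real k / real n + 2 * (1 / real n) = (real k + 2) / real n"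
        by (simp add: add_divide_distrib)
      then show "real k / real n + 2 * (1 / real n) \<le> 1"
        using k m by simp
    qed (use m in auto)
    then have "\<bar>f (real k / real n) - 2 * f (real (k + 1) / real n) + f (real (k + 2) / real n)\<bar>
        \<le> 1 / real n * omega1 f' (1 / real n)"
      by (simp add: add_divide_distrib add.commute)
    \<comment> \<open>The constant \<open>1/8\<close> is \<open>1/2\<close> times the maximum
      \<open>1/4\<close> of \<open>x * (1 - x)\<close>; the factor \<open>n\<close> cancels the step
      width \<open>1 / n\<close>.\<close>
    then have "\<bar>real n / 2 * (x * (1 - x)) *
        (f (real k / real n) - 2 * f (real (k + 1) / real n) + f (real (k + 2) / real n))\<bar>
        \<le> (real n / 2 * (1 / 4)) * (1 / real n * omega1 f' (1 / real n))"
      using x mult_one_minus_le_quarter[of x] unfolding abs_mult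
      by (intro mult_mono) auto
    also have "(real n / 2 * (1 / 4)) * (1 / real n * omega1 f' (1 / real n)) = 1 / 8 * omega1 f' (1 / real n)"
      using n by simp
    finally have 1: "\<bar>real n / 2 * (x * (1 - x)) *
        (f (real k / real n) - 2 * f (real (k + 1) / real n) + f (real (k + 2) / real n))\<bar>
        \<le> 1 / 8 * omega1 f' (1 / real n)" .
    \<comment> \<open>As \<open>n = m + 2\<close>, the node \<open>p = k / m\<close> lies between
      \<open>k / n\<close> and \<open>(k + 2) / n\<close>, at distances \<open>2 / n * p\<close> and
      \<open>2 / n * (1 - p)\<close>. Each is at most \<open>2 / n\<close>.\<close>
    have "\<bar>f (real k / real n) - f p\<bar> \<le> M * \<bar>real k / real n - p\<bar>"
      unfolding M_def using p k m by (intro lipschitz_01[OF df cont]) auto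
    also have "real k / real n - p = - (2 / real n * p)"
      using m by (simp add: p(3) field_simps)
    also have "M * \<bar>- (2 / real n * p)\<bar> \<le> 2 / real n * M"
      using p M mult_left_mono[of p 1 "2 / real n * M"] by (simp add: abs_mult ac_simps)
    finally have 2: "\<bar>f (real k / real n) - f p\<bar> \<le> 2 / real n * M" .
    have "\<bar>f (real (k + 2) / real n) - f p\<bar> \<le> M * \<bar>real (k + 2) / real n - p\<bar>"
      unfolding M_def using p k m by (intro lipschitz_01[OF df cont]) auto
    also have "real (k + 2) / real n - p = 2 / real n * (1 - p)"
      using m by (simp add: p(3) field_simps)
    also have "M * \<bar>2 / real n * (1 - p)\<bar> \<le> 2 / real n * M"
      using p M mult_left_mono[of "1 - p" 1 "2 / real n * M"] by (simp add: abs_mult ac_simps)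
    finally have 3: "\<bar>f (real (k + 2) / real n) - f p\<bar> \<le> 2 / real n * M" .
    \<comment> \<open>A convex combination: the two shift errors are averaged rather than added, so
      the constant stays 2.\<close>
    have "\<bar>(1 - x) * (f (real k / real n) - f p) + x * (f (real (k + 2) / real n) - f p)\<bar>
        \<le> (1 - x) * \<bar>f (real k / real n) - f p\<bar> + x * \<bar>f (real (k + 2) / real n) - f p\<bar>"
      using x by (intro order_trans[OF abs_triangle_ineq]) (simp add: abs_mult)
    also have "\<dots> \<le> (1 - x) * (2 / real n * M) + x * (2 / real n * M)"
      using x 2 3 by (intro add_mono mult_left_mono) auto
    also have "\<dots> = 2 / real n * M"
      by (simp only: diff_add_cancel mult_1 flip: distrib_right)
    finally have 4: "\<bar>(1 - x) * (f (real k / real n) - f p) + x * (f (real (k + 2) / real n) - f p)\<bar>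
        \<le> 2 / real n * M" .
    have "G k - f p = ((1 - x) * (f (real k / real n) - f p) + x * (f (real (k + 2) / real n) - f p))
        - real n / 2 * (x * (1 - x)) *
        (f (real k / real n) - 2 * f (real (k + 1) / real n) + f (real (k + 2) / real n))"
      unfolding G_def by (simp add: algebra_simps)
    then show ?thesis
      using 1 4 unfolding p_def by linarith
  qed
  have "bernstein_M2 n f x - (\<Sum>k\<le>m. Bernstein m k x * f (real k / real m))
      = (\<Sum>k\<le>m. Bernstein m k x * (G k - f (real k / real m)))"
    using n by (simp add: bernstein_M2_eq G_def m_def right_diff_distrib sum_subtractf)
  then have "\<bar>bernstein_M2 n f x - (\<Sum>k\<le>m. Bernstein m k x * f (real k / real m))\<bar>
      \<le> (\<Sum>k\<le>m. Bernstein m k x * (1 / 8 * omega1 f' (1 / real n) + 2 / real n * M))"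
    using abs_sum_Bernstein_le[OF x G] by simp
  also have "\<dots> = 1 / 8 * omega1 f' (1 / real n) + 2 / real n * M"
    by (simp only: sum_Bernstein mult_1 flip: sum_distrib_right)
  finally have "\<bar>bernstein_M2 n f x - (\<Sum>k\<le>m. Bernstein m k x * f (real k / real m))\<bar>
      \<le> 1 / 8 * omega1 f' (1 / real n) + 2 / real n * M" .
  moreover have "real m = real n - 2"
    using m by simp
  ultimately show ?thesis
    using Bernstein_error_C1[OF df cont x m(1)] unfolding M_def by simp
qed

section \<open>Passage to the limit and the final statements\<close>

lemma filterlim_inverse_at_right_0:
  assumes "filterlim g at_top F"
  shows "filterlim (\<lambda>n. 1 / g n :: real) (at_right 0) F"
  using filterlim_compose[OF filterlim_inverse_at_right_top assms] by (simp add: inverse_eq_divide)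

theorem theorem5p1:
  "(\<forall>f\<in>C1_01.
      (\<forall>n::nat. n \<ge> 3 \<longrightarrow>
         sup_norm01 (\<lambda>x. bernstein_M2 n f x - f x)
           \<le> 1 / 8 * omega1 (deriv01 f) (1 / real n)
             + 1 / sqrt (real n - 2) * omega1 (deriv01 f) (1 / sqrt (real n - 2))
             + 2 / real n * sup_norm01 (deriv01 f)) \<and>
      (\<lambda>n::nat. 1 / 8 * omega1 (deriv01 f) (1 / real n)
             + 1 / sqrt (real n - 2) * omega1 (deriv01 f) (1 / sqrt (real n - 2))
             + 2 / real n * sup_norm01 (deriv01 f)) \<in> o(\<lambda>_. 1)) \<and>
   (\<forall>f\<in>C2_01.
      (\<lambda>n::nat. sup_norm01 (\<lambda>x. bernstein_M2 n f x - f x)) \<in> O(\<lambda>n. 1 / real n))"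
proof (intro conjI ballI allI impI)
  fix f and n :: nat assume f: "f \<in> C1_01" and n: "3 \<le> n"
  show "sup_norm01 (\<lambda>x. bernstein_M2 n f x - f x)
      \<le> 1 / 8 * omega1 (deriv01 f) (1 / real n)
        + 1 / sqrt (real n - 2) * omega1 (deriv01 f) (1 / sqrt (real n - 2))
        + 2 / real n * sup_norm01 (deriv01 f)"
    using n C1_01_has_real_derivative[OF f] C1_01_continuous_deriv[OF f]
    by (intro sup_norm01_le bernstein_M2_error_C1)
next
  fix f assume f: "f \<in> C1_01"
  have lim1: "filterlim (\<lambda>n. 1 / real n) (at_right 0) sequentially"
    by (intro filterlim_inverse_at_right_0 filterlim_real_sequentially)
  have "filterlim (\<lambda>n. sqrt (real n - 2)) at_top sequentially"
    by (rule filterlim_compose[OF sqrt_at_top])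
      (simp add: filterlim_tendsto_add_at_top[OF tendsto_const filterlim_real_sequentially, of "-2", simplified])
  then have lim2: "filterlim (\<lambda>n. 1 / sqrt (real n - 2)) (at_right 0) sequentially"
    by (rule filterlim_inverse_at_right_0)
  have zero: "g \<longlonglongrightarrow> 0" if "filterlim g (at_right 0) sequentially" for g :: "nat \<Rightarrow> real"
    using that by (simp add: filterlim_at)
  note omega = omega1_tendsto_0[OF C1_01_continuous_deriv[OF f]]
  \<comment> \<open>The last term is written with \<open>2 * (1 / real n)\<close> so that
    \<open>lim1\<close> applies to it directly.\<close>
  have "(\<lambda>n. 1 / 8 * omega1 (deriv01 f) (1 / real n)
      + 1 / sqrt (real n - 2) * omega1 (deriv01 f) (1 / sqrt (real n - 2))
      + 2 * (1 / real n) * sup_norm01 (deriv01 f))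
      \<longlonglongrightarrow> 1 / 8 * 0 + 0 * 0 + 2 * 0 * sup_norm01 (deriv01 f)"
    by (intro tendsto_intros filterlim_compose[OF omega] lim1 lim2 zero)
  then show "(\<lambda>n::nat. 1 / 8 * omega1 (deriv01 f) (1 / real n)
      + 1 / sqrt (real n - 2) * omega1 (deriv01 f) (1 / sqrt (real n - 2))
      + 2 / real n * sup_norm01 (deriv01 f)) \<in> o(\<lambda>_. 1)"
    by (intro smalloI_tendsto) auto
next
  fix f assume "f \<in> C2_01"
  then have f: "f \<in> C1_01" "deriv01 f \<in> C1_01"
    by (auto simp: C2_01_def)
  note cont = C1_01_continuous_deriv[OF f(1)]
  define K where "K = sup_norm01 (deriv01 (deriv01 f))"
  define M where "M = sup_norm01 (deriv01 f)"
  have K: "0 \<le> K"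
    unfolding K_def using sup_norm01_upper[OF C1_01_continuous_deriv[OF f(2)]]
    by (rule sup_norm01_nonneg)
  \<comment> \<open>For twice continuously differentiable \<open>f\<close> the derivative is
    Lipschitz, so its modulus is linear in \<open>\<delta>\<close>. The middle term of the bound
    thereby becomes \<open>K / (n - 2)\<close>.\<close>
  have omega: "omega1 (deriv01 f) \<delta> \<le> K * \<delta>" if "0 \<le> \<delta>" for \<delta>
  proof (rule omega1_le[OF that])
    fix s t :: real assume st: "s \<in> {0..1}" "t \<in> {0..1}" "\<bar>s - t\<bar> \<le> \<delta>"
    have "\<bar>deriv01 f s - deriv01 f t\<bar> \<le> K * \<bar>s - t\<bar>"
      unfolding K_def using st C1_01_has_real_derivative[OF f(2)] C1_01_continuous_deriv[OF f(2)]
      by (intro lipschitz_01)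
    also have "\<dots> \<le> K * \<delta>"
      using st K by (intro mult_left_mono)
    finally show "\<bar>deriv01 f s - deriv01 f t\<bar> \<le> K * \<delta>" .
  qed
  have le: "norm (sup_norm01 (\<lambda>x. bernstein_M2 n f x - f x)) \<le> (K / 8 + 3 * K + 2 * M) * norm (1 / real n)"
    if n: "3 \<le> n" for n :: nat
  proof -
    define R where "R = 1 / 8 * omega1 (deriv01 f) (1 / real n)
        + 1 / sqrt (real n - 2) * omega1 (deriv01 f) (1 / sqrt (real n - 2)) + 2 / real n * M"
    have bound: "\<bar>bernstein_M2 n f x - f x\<bar> \<le> R" if "x \<in> {0..1}" for x
      unfolding R_def M_def using that n C1_01_has_real_derivative[OF f(1)] cont
      by (intro bernstein_M2_error_C1)
    have n2: "0 < real n - 2"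
      using n by linarith
    have "1 / sqrt (real n - 2) * omega1 (deriv01 f) (1 / sqrt (real n - 2))
        \<le> 1 / sqrt (real n - 2) * (K * (1 / sqrt (real n - 2)))"
      using n2 by (intro mult_left_mono omega) auto
    also have "\<dots> = K * (1 / (real n - 2))"
      using n2 by (simp flip: real_sqrt_mult)
    \<comment> \<open>For \<open>n \<ge> 3\<close> one has \<open>n \<le> 3 * (n - 2)\<close>, with
      equality at \<open>n = 3\<close>.\<close>
    also have "\<dots> \<le> K * (3 / real n)"
      using n K by (intro mult_left_mono) (auto simp: field_simps)
    finally have "R \<le> 1 / 8 * (K * (1 / real n)) + K * (3 / real n) + 2 / real n * M"
      unfolding R_def using omega[of "1 / real n"] by simp
    also have "\<dots> = (K / 8 + 3 * K + 2 * M) * norm (1 / real n)"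
      using n by (simp add: field_simps)
    finally have "R \<le> (K / 8 + 3 * K + 2 * M) * norm (1 / real n)" .
    \<comment> \<open>The Landau bound concerns the norm of the sup norm, so its nonnegativity is
      needed as well.\<close>
    then show ?thesis
      using sup_norm01_le[of "\<lambda>x. bernstein_M2 n f x - f x" R, OF bound]
        sup_norm01_nonneg[of "\<lambda>x. bernstein_M2 n f x - f x" R, OF bound] by simp
  qed
  show "(\<lambda>n::nat. sup_norm01 (\<lambda>x. bernstein_M2 n f x - f x)) \<in> O(\<lambda>n. 1 / real n)"
    using le by (intro bigoI eventually_sequentiallyI[of 3])
qed

end
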